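(* Let $\mathbf X\in\mathbb R^{n\times d}$ with $n\ge d$ be a full rank matrix and let $S\subseteq\{1,\dots,n\}$ be sampled according to size $d$ volume sampling from $\mathbf X$. If $\mathbf X$ is in general position, then $$\mathbb E\big[(\mathbf I_S\mathbf X)^{+\top}\mathbf X^\top\mathbf X(\mathbf I_S\mathbf X)^+\big]-\mathbf P_{\mathbf X}=d\,(\mathbf I-\mathbf P_{\mathbf X}).$$ If $\mathbf X$ is not in general position, then $$\mathbb E\big[(\mathbf I_S\mathbf X)^{+\top}\mathbf X^\top\mathbf X(\mathbf I_S\mathbf X)^+\big]-\mathbf P_{\mathbf X}\preceq d\,(\mathbf I-\mathbf P_{\mathbf X}).$$
   Context: $\mathbf X_S$ is the submatrix of the rows of $\mathbf X$ indexed by $S$. $\mathbf I_S$ is the $n\times n$ diagonal matrix with $(\mathbf I_S)_{ii}=1$ if $i\in S$ and $0$ otherwise; $\mathbf I$ is the $n\times n$ identity. $^+$ is the Moore–Penrose pseudoinverse and $\mathbf A^{+\top}=(\mathbf A^+)^\top$. $\mathbf P_{\mathbf X}=\mathbf X(\mathbf X^\top\mathbf X)^{-1}\mathbf X^\top$ is the orthogonal projection onto the column span of $\mathbf X$. Size $d$ volume sampling selects a $d$-element set $S$ with probability $\det(\mathbf X_S^\top\mathbf X_S)/\det(\mathbf X^\top\mathbf X)$. $\mathbf X$ is in general position if $\det(\mathbf X_S^\top\mathbf X_S)>0$ for every $d$-element set $S$. $\mathbf A\preceq\mathbf B$ means that $\mathbf B-\mathbf A$ is positive semidefinite. *)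

theory Defs
  imports
    "HOL-Probability.Probability_Mass_Function"
    "Jordan_Normal_Form.Matrix"
    "Jordan_Normal_Form.Determinant"
    "Jordan_Normal_Form.Gauss_Jordan_Elimination"
    "Jordan_Normal_Form.DL_Rank"
    "Jordan_Normal_Form.DL_Submatrix"
begin

no_notation Finite_Cartesian_Product.vec_nth (infixl "$" 90)
no_notation Inner_Product.real_inner_class.inner (infix "\<bullet>" 70)

hide_const (open) Determinants.det Finite_Cartesian_Product.mat Finite_Cartesian_Product.vec

text \<open>
  Matrices are those of the Jordan_Normal_Form library; rows are indexed by
  \<open>{0..<n}\<close>, so subsets of \<open>{1,\<dots>,n}\<close> become subsets of \<open>{0..<n}\<close>.
\<close>

definition is_pseudoinverse :: "real mat \<Rightarrow> real mat \<Rightarrow> bool" where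
  "is_pseudoinverse A B \<longleftrightarrow>
     B \<in> carrier_mat (dim_col A) (dim_row A) \<and>
     A * B * A = A \<and> B * A * B = B \<and>
     transpose_mat (A * B) = A * B \<and> transpose_mat (B * A) = B * A"

definition pseudoinverse :: "real mat \<Rightarrow> real mat" where
  "pseudoinverse A = (THE B. is_pseudoinverse A B)"

lemma is_pseudoinverse_unique:
  assumes B: "is_pseudoinverse A B" and C: "is_pseudoinverse A C"
  shows "B = C"
proof -
  define m n where "m = dim_row A" and "n = dim_col A"
  have dA: "A \<in> carrier_mat m n" by (simp add: m_def n_def)
  have dB: "B \<in> carrier_mat n m" and dC: "C \<in> carrier_mat n m"
    using B C by (simp_all add: is_pseudoinverse_def m_def n_def)
  have AB: "A * B = A * C"
  proof -
    have "A * B = transpose_mat (A * B)" using B by (simp add: is_pseudoinverse_def)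
    also have "\<dots> = transpose_mat ((A * C) * (A * B))"
      using C dA dB dC by (simp add: is_pseudoinverse_def flip: assoc_mult_mat[of "A * C" m m A n B m])
    also have "\<dots> = transpose_mat (A * B) * transpose_mat (A * C)"
      using dA dB dC by (intro transpose_mult[of _ m m _ m]) auto
    also have "\<dots> = (A * B) * (A * C)" using B C by (simp add: is_pseudoinverse_def)
    also have "\<dots> = A * C"
      using B dA dB dC by (simp add: is_pseudoinverse_def flip: assoc_mult_mat[of "A * B" m m A n C m])
    finally show ?thesis .
  qed
  have BA: "B * A = C * A"
  proof -
    have "B * A = transpose_mat (B * A)" using B by (simp add: is_pseudoinverse_def)
    also have "\<dots> = transpose_mat ((B * A) * (C * A))"
    proof -
      have "(B * A) * (C * A) = B * (A * (C * A))"
        using dA dB dC by (intro assoc_mult_mat[of _ n m _ n _ n]) auto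
      also have "A * (C * A) = A * C * A"
        using dA dC by (intro assoc_mult_mat[of _ m n _ m _ n, symmetric]) auto
      finally show ?thesis using C by (simp add: is_pseudoinverse_def)
    qed
    also have "\<dots> = transpose_mat (C * A) * transpose_mat (B * A)"
      using dA dB dC by (intro transpose_mult[of _ n n _ n]) auto
    also have "\<dots> = (C * A) * (B * A)" using B C by (simp add: is_pseudoinverse_def)
    also have "\<dots> = C * (A * (B * A))"
      using dA dB dC by (intro assoc_mult_mat[of _ n m _ n _ n]) auto
    also have "A * (B * A) = A * B * A"
      using dA dB by (intro assoc_mult_mat[of _ m n _ m _ n, symmetric]) auto
    also have "C * (A * B * A) = C * A" using B by (simp add: is_pseudoinverse_def)
    finally show ?thesis .
  qed
  have "B = B * A * B" using B by (simp add: is_pseudoinverse_def)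
  also have "\<dots> = C * (A * B)" unfolding BA
    using dA dB dC by (intro assoc_mult_mat[of _ n m _ n _ m]) auto
  also have "\<dots> = C * A * C" unfolding AB
    using dA dC by (intro assoc_mult_mat[of _ n m _ n _ m, symmetric]) auto
  also have "\<dots> = C" using C by (simp add: is_pseudoinverse_def)
  finally show ?thesis .
qed

lemma pseudoinverse_eqI: "is_pseudoinverse A B \<Longrightarrow> pseudoinverse A = B"
  unfolding pseudoinverse_def by (blast intro: the_equality is_pseudoinverse_unique)

definition row_submatrix :: "real mat \<Rightarrow> nat set \<Rightarrow> real mat" where
  "row_submatrix X S = submatrix X S UNIV"

definition diag_indicator :: "nat \<Rightarrow> nat set \<Rightarrow> real mat" where
  "diag_indicator n S = mat_diag n (\<lambda>i. if i \<in> S then 1 else 0)"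

definition gram :: "real mat \<Rightarrow> real mat" where
  "gram A = transpose_mat A * A"

text \<open>\<^const>\<open>mat_inverse\<close> is \<open>None\<close> for singular matrices, so this is meaningful only when
  \<open>X\<close> has full column rank.\<close>

definition proj_col_span :: "real mat \<Rightarrow> real mat" where
  "proj_col_span X = X * the (mat_inverse (gram X)) * transpose_mat X"

text \<open>For \<open>X\<close> of full column rank the weights below sum to one, by the Cauchy--Binet formula,
  so that \<^const>\<open>embed_pmf\<close> yields the distribution with exactly these probabilities.\<close>

definition volume_sampling :: "real mat \<Rightarrow> nat set pmf" where
  "volume_sampling X = embed_pmf (\<lambda>S.
     if S \<subseteq> {0..<dim_row X} \<and> card S = dim_col X
     then det (gram (row_submatrix X S)) / det (gram X) else 0)"

definition general_position :: "real mat \<Rightarrow> bool" where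
  "general_position X \<longleftrightarrow>
     (\<forall>S. S \<subseteq> {0..<dim_row X} \<and> card S = dim_col X \<longrightarrow> det (gram (row_submatrix X S)) > 0)"

definition expectation_mat :: "nat \<Rightarrow> nat \<Rightarrow> 'a pmf \<Rightarrow> ('a \<Rightarrow> real mat) \<Rightarrow> real mat" where
  "expectation_mat nr nc p F =
     mat nr nc (\<lambda>(i, j). measure_pmf.expectation p (\<lambda>S. F S $$ (i, j)))"

definition psd :: "real mat \<Rightarrow> bool" where
  "psd A \<longleftrightarrow> square_mat A \<and> transpose_mat A = A \<and>
     (\<forall>v \<in> carrier_vec (dim_row A). v \<bullet> (A *\<^sub>v v) \<ge> 0)"

text \<open>The order \<open>\<le>\<close> on \<^typ>\<open>real mat\<close> in the library is entrywise, hence a separate symbol.\<close>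

definition loewner_le :: "real mat \<Rightarrow> real mat \<Rightarrow> bool" (infix "\<preceq>\<^sub>L" 50) where
  "A \<preceq>\<^sub>L B \<longleftrightarrow> dim_row A = dim_row B \<and> dim_col A = dim_col B \<and> psd (B - A)"

end

theory Submission
  imports Defs
begin

text \<open>
  Subsets of size \<open>d\<close> are replaced by tuples \<open>f\<close> of row indices, each nonsingular subset being hit
  \<open>d!\<close> times; the weight of \<open>f\<close> is \<open>(det X\<^sub>f)\<^sup>2\<close>. For nonsingular \<open>X\<^sub>f\<close> and a response vector \<open>v\<close>,
  the vector \<open>(I\<^sub>S X)\<^sup>+ v\<close> interpolates \<open>v\<close> on the selected rows, and by a Schur complement the
  residual of \<open>v\<close> at a further row \<open>k\<close>, multiplied by \<open>det X\<^sub>f\<close>, is the minor of the augmented matrix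
  \<open>[X, v]\<close> in the rows \<open>(f, k)\<close>. The Cauchy--Binet formula for \<open>[X, v]\<close> and \<open>[X, w]\<close> therefore
  evaluates the expected product of the residuals of \<open>v\<close> and \<open>w\<close>, up to the minors in rows \<open>(f, k)\<close>
  with \<open>det X\<^sub>f = 0\<close>. Expanding the product and using unbiasedness of the sampled least squares fit
  gives the bilinear form of the expectation. The omitted minors contribute a sum of squares for
  \<open>v = w\<close>, and in general position they vanish because \<open>f\<close> then repeats an index.
\<close>

section \<open>Inverses and bordered determinants\<close>

lemma obtain_inverse_mat:
  fixes A :: "'a :: field mat"
  assumes A: "A \<in> carrier_mat n n" and det: "det A \<noteq> 0"
  obtains B where "B \<in> carrier_mat n n" "A * B = 1\<^sub>m n" "B * A = 1\<^sub>m n"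
proof
  let ?B = "(1 / det A) \<cdot>\<^sub>m adj_mat A"
  note adj = adj_mat[OF A]
  show "?B \<in> carrier_mat n n" using adj by simp
  have "A * ?B = (1 / det A) \<cdot>\<^sub>m (A * adj_mat A)" by (rule mult_smult_distrib[OF A adj(1)])
  then show "A * ?B = 1\<^sub>m n" using det adj by auto
  have "?B * A = (1 / det A) \<cdot>\<^sub>m (adj_mat A * A)" by (rule mult_smult_assoc_mat[OF adj(1) A])
  then show "?B * A = 1\<^sub>m n" using det adj by auto
qed

text \<open>A Schur complement formula in which \<open>Y\<close> stands for the inverse of
  \<open>A\<close> times the upper right block, so that no division occurs. The matrix factors into
  a block lower and a block upper triangular matrix.\<close>

lemma det_four_block_mat_solution:
  fixes A :: "'a :: idom mat"
  assumes A: "A \<in> carrier_mat m m" and Y: "Y \<in> carrier_mat m k"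
    and C: "C \<in> carrier_mat k m" and D: "D \<in> carrier_mat k k"
  shows "det (four_block_mat A (A * Y) C D) = det A * det (D - C * Y)"
proof -
  let ?S = "D - C * Y"
  let ?L = "four_block_mat A (0\<^sub>m m k) C (1\<^sub>m k)" and ?U = "four_block_mat (1\<^sub>m m) Y (0\<^sub>m k m) ?S"
  have S: "?S \<in> carrier_mat k k" using C Y by (intro minus_carrier_mat mult_carrier_mat)
  have "C * Y + 1\<^sub>m k * ?S = D"
    unfolding left_mult_one_mat[OF S] using C Y D by (intro eq_matI) auto
  then have "?L * ?U = four_block_mat A (A * Y) C D"
    using A Y C S mult_four_block_mat[OF A zero_carrier_mat C one_carrier_mat one_carrier_mat Y zero_carrier_mat S]
    by simp
  moreover have "det ?L = det A"
    using det_four_block_mat_upper_right_zero[OF A refl C one_carrier_mat] by simp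
  moreover have "det ?U = det ?S"
    using det_four_block_mat_lower_left_zero[OF one_carrier_mat Y refl S] by simp
  moreover have "det (?L * ?U) = det ?L * det ?U"
    using A S by (intro det_mult[of _ "m + k"]) auto
  ultimately show ?thesis by simp
qed

text \<open>The case of a border of width one. It serves twice: for a square block of selected rows
  bordered by a further row and the response, and for the Gram matrix of an augmented
  matrix.\<close>

lemma det_bordered:
  fixes A :: "'a :: idom mat"
  assumes A: "A \<in> carrier_mat m m" and y: "y \<in> carrier_vec m" and c: "c \<in> carrier_vec m"
    and b: "A *\<^sub>v y = b"
  shows "det (four_block_mat A (mat m 1 (\<lambda>(i, _). b $ i)) (mat 1 m (\<lambda>(_, j). c $ j)) (mat 1 1 (\<lambda>_. e)))
    = det A * (e - c \<bullet> y)"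
proof -
  let ?Y = "mat m 1 (\<lambda>(i, _). y $ i)" and ?C = "mat 1 m (\<lambda>(_, j). c $ j)" and ?D = "mat 1 1 (\<lambda>_. e)"
  have col: "col ?Y 0 = y" using y by auto
  have row: "row ?C 0 = c" using c by auto
  have B: "A * ?Y = mat m 1 (\<lambda>(i, _). b $ i)"
    using A b col by (intro eq_matI) auto
  have "det (?D - ?C * ?Y) = e - c \<bullet> y"
    using col row by (subst det_single) auto
  then show ?thesis using det_four_block_mat_solution[OF A, of ?Y 1 ?C ?D] B by simp
qed

section \<open>Selecting rows by index tuples\<close>

text \<open>A function in place of a set admits repeated and reordered rows, over which the
  Cauchy-Binet sums run.\<close>

definition select_rows :: "nat \<Rightarrow> (nat \<Rightarrow> nat) \<Rightarrow> 'a mat \<Rightarrow> 'a mat" where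
  "select_rows k f A = mat k (dim_col A) (\<lambda>(i, j). A $$ (f i, j))"

lemma select_rows_carrier [simp]:
  "select_rows k f A \<in> carrier_mat k m \<longleftrightarrow> dim_col A = m"
  by (auto simp: select_rows_def)

lemma dim_select_rows [simp]:
  "dim_row (select_rows k f A) = k" "dim_col (select_rows k f A) = dim_col A"
  by (simp_all add: select_rows_def)

lemma index_select_rows [simp]:
  "i < k \<Longrightarrow> j < dim_col A \<Longrightarrow> select_rows k f A $$ (i, j) = A $$ (f i, j)"
  by (simp add: select_rows_def)

lemma row_select_rows [simp]:
  "i < k \<Longrightarrow> f i < dim_row A \<Longrightarrow> row (select_rows k f A) i = row A (f i)"
  by (intro eq_vecI) auto

lemma det_select_rows_not_inj:
  fixes A :: "'a :: comm_ring_1 mat"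
  assumes A: "A \<in> carrier_mat n m" and f: "\<not> inj_on f {0..<m}"
  shows "det (select_rows m f A) = 0"
proof -
  obtain i j where ij: "i < m" "j < m" "i \<noteq> j" "f i = f j"
    using f by (auto simp: inj_on_def)
  then have "row (select_rows m f A) i = row (select_rows m f A) j"
    using A by (intro eq_vecI) (auto simp: select_rows_def)
  with ij A show ?thesis
    by (intro det_identical_rows[OF _ ij(3,1,2)]) auto
qed

section \<open>The Cauchy-Binet formula as a sum over tuples\<close>

text \<open>The inverse map composes with the inverse permutation; \<open>restrict\<close> keeps the
  results extensional. This reindexing of tuples absorbs row permutations in the Cauchy-Binet
  formula.\<close>

lemma bij_betw_PiE_compose_permutes:
  assumes p: "p permutes I"
  shows "bij_betw (\<lambda>f. restrict (f \<circ> p) I) (I \<rightarrow>\<^sub>E S) (I \<rightarrow>\<^sub>E S)"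
proof (rule bij_betwI[where g = "\<lambda>f. restrict (f \<circ> inv_into UNIV p) I"])
  note q = permutes_inv[OF p]
  \<comment> \<open>Stated for an arbitrary pair \<open>r\<close>, \<open>s\<close>, because the two
    directions of the bijection use it with \<open>p\<close> and its inverse in exchanged
    roles.\<close>
  have inverse: "restrict (restrict (f \<circ> r) I \<circ> s) I = f"
    if "f \<in> I \<rightarrow>\<^sub>E S" "s permutes I" "\<And>i. r (s i) = i" for f and r s :: "'a \<Rightarrow> 'a"
  proof (rule ext)
    fix i
    show "restrict (restrict (f \<circ> r) I \<circ> s) I i = f i"
      using that(3)[of i] permutes_in_image[OF that(2), of i] PiE_arb[OF that(1), of i]
      by (simp add: restrict_def)
  qed
  show "(\<lambda>f. restrict (f \<circ> p) I) \<in> (I \<rightarrow>\<^sub>E S) \<rightarrow> (I \<rightarrow>\<^sub>E S)"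
    "(\<lambda>f. restrict (f \<circ> inv_into UNIV p) I) \<in> (I \<rightarrow>\<^sub>E S) \<rightarrow> (I \<rightarrow>\<^sub>E S)"
    using permutes_in_image[OF p] permutes_in_image[OF q] by auto
  show "restrict (restrict (f \<circ> p) I \<circ> inv_into UNIV p) I = f" if "f \<in> I \<rightarrow>\<^sub>E S" for f
    by (rule inverse[OF that q]) (rule permutes_inverses(1)[OF p])
  show "restrict (restrict (f \<circ> inv_into UNIV p) I \<circ> p) I = f" if "f \<in> I \<rightarrow>\<^sub>E S" for f
    by (rule inverse[OF that p]) (rule permutes_inverses(2)[OF p])
qed

text \<open>In the Leibniz expansion each entry of the product is a sum over rows. Multiplying out
  chooses a row \<open>f j\<close> for each column \<open>j\<close> of \<open>A\<close>; for fixed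
  \<open>f\<close> the signed sum over permutations is a minor of \<open>B\<close>.\<close>

lemma det_transpose_mult_eq_sum:
  fixes A B :: "'a :: comm_ring_1 mat"
  assumes A: "A \<in> carrier_mat n m" and B: "B \<in> carrier_mat n m"
  shows "det (transpose_mat A * B)
    = (\<Sum>f\<in>{0..<m} \<rightarrow>\<^sub>E {0..<n}. (\<Prod>j = 0..<m. A $$ (f j, j)) * det (select_rows m f B))"
proof -
  let ?F = "{0..<m} \<rightarrow>\<^sub>E {0..<n}" and ?P = "{p. p permutes {0..<m}}"
  have "det (transpose_mat A * B)
      = (\<Sum>p\<in>?P. signof p * (\<Prod>j = 0..<m. \<Sum>i\<in>{0..<n}. A $$ (i, j) * B $$ (i, p j)))"
  proof (subst det_def'[of _ m])
    show "(\<Sum>p\<in>?P. signof p * (\<Prod>i = 0..<m. (transpose_mat A * B) $$ (i, p i)))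
      = (\<Sum>p\<in>?P. signof p * (\<Prod>j = 0..<m. \<Sum>i\<in>{0..<n}. A $$ (i, j) * B $$ (i, p j)))"
    proof (intro sum.cong refl arg_cong2[of _ _ _ _ "(*)"] prod.cong)
      fix p j assume "p \<in> ?P" "j \<in> {0..<m}"
      moreover from this have "p j < m" using permutes_in_image[of p "{0..<m}" j] by auto
      ultimately show "(transpose_mat A * B) $$ (j, p j) = (\<Sum>i\<in>{0..<n}. A $$ (i, j) * B $$ (i, p j))"
        using A B by (simp add: scalar_prod_def)
    qed
  qed (use A B in auto)
  also have "\<dots> = (\<Sum>p\<in>?P. signof p * (\<Sum>f\<in>?F. \<Prod>j = 0..<m. A $$ (f j, j) * B $$ (f j, p j)))"
    by (subst prod_sum_PiE) auto
  also have "\<dots> = (\<Sum>f\<in>?F. \<Sum>p\<in>?P. signof p * (\<Prod>j = 0..<m. A $$ (f j, j) * B $$ (f j, p j)))"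
    unfolding sum_distrib_left by (rule sum.swap)
  also have "\<dots> = (\<Sum>f\<in>?F. (\<Prod>j = 0..<m. A $$ (f j, j)) * det (select_rows m f B))"
  proof (rule sum.cong[OF refl])
    fix f
    have "B $$ (f j, p j) = select_rows m f B $$ (j, p j)" if "p \<in> ?P" "j < m" for p j
      using that B permutes_in_image[of p "{0..<m}" j] by auto
    then show "(\<Sum>p\<in>?P. signof p * (\<Prod>j = 0..<m. A $$ (f j, j) * B $$ (f j, p j)))
        = (\<Prod>j = 0..<m. A $$ (f j, j)) * det (select_rows m f B)"
      using B by (subst det_def'[of _ m])
        (auto simp: prod.distrib sum_distrib_left mult_ac intro!: sum.cong)
  qed
  finally show ?thesis .
qed

text \<open>Expand the minor of \<open>A\<close> over permutations \<open>p\<close>. For fixed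
  \<open>p\<close>, passing from \<open>f\<close> to its composition with \<open>p\<close> absorbs
  the sign into the minor of \<open>B\<close> and leaves the expansion of
  \<open>det_transpose_mult_eq_sum\<close>, so each of the \<open>fact m\<close> permutations
  contributes the same determinant.\<close>

lemma cauchy_binet_functions:
  fixes A B :: "'a :: comm_ring_1 mat"
  assumes A: "A \<in> carrier_mat n m" and B: "B \<in> carrier_mat n m"
  shows "(\<Sum>f\<in>{0..<m} \<rightarrow>\<^sub>E {0..<n}. det (select_rows m f A) * det (select_rows m f B))
    = of_nat (fact m) * det (transpose_mat A * B)"
proof -
  let ?F = "{0..<m} \<rightarrow>\<^sub>E {0..<n}" and ?P = "{p. p permutes {0..<m}}"
  let ?b = "\<lambda>f. det (select_rows m f B)"
  have "(\<Sum>f\<in>?F. det (select_rows m f A) * ?b f)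
      = (\<Sum>f\<in>?F. \<Sum>p\<in>?P. (\<Prod>j = 0..<m. A $$ (f (p j), j)) * (signof p * ?b f))"
  proof (rule sum.cong[OF refl])
    fix f
    \<comment> \<open>The Leibniz formula is applied to the transpose so that \<open>p\<close> acts
      on the row position, as in \<open>f (p j)\<close>, where a change of the tuple can absorb
      it.\<close>
    have "det (select_rows m f A)
      = (\<Sum>p\<in>?P. signof p * (\<Prod>j = 0..<m. transpose_mat (select_rows m f A) $$ (j, p j)))"
      using det_transpose[of "select_rows m f A" m] det_def'[of "transpose_mat (select_rows m f A)" m] A
      by simp
    also have "\<dots> = (\<Sum>p\<in>?P. signof p * (\<Prod>j = 0..<m. A $$ (f (p j), j)))"
    proof (intro sum.cong refl arg_cong2[of _ _ _ _ "(*)"] prod.cong)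
      fix p j assume "p \<in> ?P" "j \<in> {0..<m}"
      then show "transpose_mat (select_rows m f A) $$ (j, p j) = A $$ (f (p j), j)"
        using A permutes_in_image[of p "{0..<m}" j] by (auto simp: select_rows_def)
    qed
    finally show "det (select_rows m f A) * ?b f
        = (\<Sum>p\<in>?P. (\<Prod>j = 0..<m. A $$ (f (p j), j)) * (signof p * ?b f))"
      by (simp add: sum_distrib_right sum_distrib_left mult_ac)
  qed
  also have "\<dots> = (\<Sum>p\<in>?P. \<Sum>f\<in>?F. (\<Prod>j = 0..<m. A $$ (f (p j), j)) * (signof p * ?b f))"
    by (rule sum.swap)
  also have "\<dots> = (\<Sum>p\<in>?P. det (transpose_mat A * B))"
  proof (rule sum.cong[OF refl])
    fix p assume "p \<in> ?P"
    then have p: "p permutes {0..<m}" by simp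
    let ?h = "\<lambda>f. restrict (f \<circ> p) {0..<m}"
    have pm: "p j < m" if "j < m" for j using permutes_in_image[OF p, of j] that by simp
    have "(\<Prod>j = 0..<m. A $$ (f (p j), j)) * (signof p * ?b f)
        = (\<Prod>j = 0..<m. A $$ (?h f j, j)) * ?b (?h f)" for f
    proof -
      have "select_rows m (?h f) B = mat m m (\<lambda>(i, j). select_rows m f B $$ (p i, j))"
        using B pm by (intro eq_matI) (auto simp: select_rows_def)
      then have "?b (?h f) = signof p * ?b f"
        using det_permute_rows[OF _ p, of "select_rows m f B"] B by simp
      then show ?thesis by simp
    qed
    then have "(\<Sum>f\<in>?F. (\<Prod>j = 0..<m. A $$ (f (p j), j)) * (signof p * ?b f))
        = (\<Sum>f\<in>?F. (\<Prod>j = 0..<m. A $$ (f j, j)) * ?b f)"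
      using sum.reindex_bij_betw[OF bij_betw_PiE_compose_permutes[OF p, of "{0..<n}"],
          of "\<lambda>f. (\<Prod>j = 0..<m. A $$ (f j, j)) * ?b f"] by simp
    then show "(\<Sum>f\<in>?F. (\<Prod>j = 0..<m. A $$ (f (p j), j)) * (signof p * ?b f))
        = det (transpose_mat A * B)"
      using det_transpose_mult_eq_sum[OF A B] by simp
  qed
  also have "\<dots> = of_nat (fact m) * det (transpose_mat A * B)"
    by (simp add: card_permutations[OF refl])
  finally show ?thesis .
qed

section \<open>Gram determinants of row submatrices\<close>

lemma gram_carrier [simp]: "A \<in> carrier_mat n m \<Longrightarrow> gram A \<in> carrier_mat m m"
  by (simp add: gram_def)

lemma det_gram_square: "A \<in> carrier_mat m m \<Longrightarrow> det (gram A) = (det A)\<^sup>2"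
  by (simp add: gram_def det_mult[of _ m] det_transpose power2_eq_square)

text \<open>Reindexing the inner sum along \<open>f\<close> leaves an expression in the selected set
  alone, so all enumerations of \<open>S\<close> share one Gram matrix.\<close>

lemma gram_select_rows:
  assumes A: "A \<in> carrier_mat n m" and f: "bij_betw f {0..<k} S"
  shows "gram (select_rows k f A) = mat m m (\<lambda>(a, b). \<Sum>i\<in>S. A $$ (i, a) * A $$ (i, b))"
proof (rule eq_matI)
  fix a b assume "a < dim_row (mat m m (\<lambda>(a, b). \<Sum>i\<in>S. A $$ (i, a) * A $$ (i, b)))"
    "b < dim_col (mat m m (\<lambda>(a, b). \<Sum>i\<in>S. A $$ (i, a) * A $$ (i, b)))"
  then have ab: "a < m" "b < m" by auto
  then have "gram (select_rows k f A) $$ (a, b) = (\<Sum>r\<in>{0..<k}. A $$ (f r, a) * A $$ (f r, b))"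
    using A by (auto simp: gram_def select_rows_def scalar_prod_def)
  also have "\<dots> = (\<Sum>i\<in>S. A $$ (i, a) * A $$ (i, b))"
    by (rule sum.reindex_bij_betw[OF f])
  finally show "gram (select_rows k f A) $$ (a, b)
      = mat m m (\<lambda>(a, b). \<Sum>i\<in>S. A $$ (i, a) * A $$ (i, b)) $$ (a, b)"
    using ab by simp
qed (use A in \<open>auto simp: gram_def select_rows_def\<close>)

lemma bij_betw_pick:
  assumes "finite S"
  shows "bij_betw (pick S) {0..<card S} S"
proof -
  have inj: "inj_on (pick S) {0..<card S}"
    by (rule linorder_inj_onI) (auto dest: pick_mono_le[of _ S])
  moreover have "pick S ` {0..<card S} \<subseteq> S"
    using pick_in_set_le by auto
  ultimately have "pick S ` {0..<card S} = S"
    using assms by (intro card_subset_eq) (auto simp: card_image)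
  with inj show ?thesis by (simp add: bij_betw_def)
qed

lemma row_submatrix_eq_select_rows:
  assumes "A \<in> carrier_mat n m" "S \<subseteq> {0..<n}"
  shows "row_submatrix A S = select_rows (card S) (pick S) A"
proof -
  have "{i. i < n \<and> i \<in> S} = S" using assms(2) by auto
  then show ?thesis
    using assms(1) by (simp add: row_submatrix_def submatrix_def select_rows_def pick_UNIV)
qed

text \<open>\<open>row_submatrix\<close> enumerates \<open>S\<close> increasingly by
  \<open>pick S\<close>; the enumeration \<open>f\<close> gives the same Gram matrix, whose
  determinant is the square of that of the selected square block.\<close>

lemma det_gram_row_submatrix:
  assumes A: "A \<in> carrier_mat n m" and S: "S \<subseteq> {0..<n}" and f: "bij_betw f {0..<m} S"
  shows "det (gram (row_submatrix A S)) = (det (select_rows m f A))\<^sup>2"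
proof -
  have "finite S" using S finite_subset by blast
  then have "gram (row_submatrix A S) = gram (select_rows m f A)"
    unfolding row_submatrix_eq_select_rows[OF A S] gram_select_rows[OF A f]
    by (intro gram_select_rows[OF A] bij_betw_pick)
  then show ?thesis using A by (simp add: det_gram_square[of _ m])
qed

section \<open>The pseudoinverse of the matrix with unselected rows set to zero\<close>

lemma row_one_mat: "i < n \<Longrightarrow> row (1\<^sub>m n) i = unit_vec n i"
  by (intro eq_vecI) (auto simp: unit_vec_def)

lemma select_rows_eq_mult:
  fixes A :: "'a :: semiring_1 mat"
  assumes A: "A \<in> carrier_mat n m" and f: "\<And>i. i < k \<Longrightarrow> f i < n"
  shows "select_rows k f (1\<^sub>m n) * A = select_rows k f A"
proof (rule eq_matI)
  fix i j assume "i < dim_row (select_rows k f A)" "j < dim_col (select_rows k f A)"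
  then have ij: "i < k" "j < m" using A by (auto simp: select_rows_def)
  then show "(select_rows k f (1\<^sub>m n) * A) $$ (i, j) = select_rows k f A $$ (i, j)"
    using ij A f[OF ij(1)] by (simp add: row_one_mat)
qed (use A in \<open>auto simp: select_rows_def\<close>)

lemma select_rows_one_mult_vec:
  fixes v :: "'a :: semiring_1 vec"
  assumes v: "v \<in> carrier_vec n" and f: "\<And>i. i < k \<Longrightarrow> f i < n"
  shows "select_rows k f (1\<^sub>m n) *\<^sub>v v = vec k (\<lambda>i. v $ f i)"
proof (rule eq_vecI)
  fix i assume "i < dim_vec (vec k (\<lambda>i. v $ f i))"
  then have i: "i < k" by simp
  then show "(select_rows k f (1\<^sub>m n) *\<^sub>v v) $ i = vec k (\<lambda>i. v $ f i) $ i"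
    using i v f[OF i] by (simp add: row_one_mat)
qed (simp add: select_rows_def)

text \<open>The rows of \<open>J\<close> are distinct unit vectors: \<open>J\<close> restricts a
  vector to the coordinates in \<open>S\<close>, and its transpose extends by zero.\<close>

lemma select_rows_one_orthonormal:
  fixes f :: "nat \<Rightarrow> nat"
  assumes f: "bij_betw f {0..<k} S" and S: "S \<subseteq> {0..<n}"
  defines "J \<equiv> select_rows k f (1\<^sub>m n) :: real mat"
  shows "J * transpose_mat J = 1\<^sub>m k" "transpose_mat J * J = diag_indicator n S"
proof -
  have fn: "f i < n" if "i < k" for i using subsetD[OF S bij_betw_apply[OF f, of i]] that by simp
  have inj: "f i = f j \<longleftrightarrow> i = j" if "i < k" "j < k" for i j
    using f that by (auto simp: bij_betw_def inj_on_def)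
  have J: "J \<in> carrier_mat k n" by (simp add: J_def)
  show "J * transpose_mat J = 1\<^sub>m k"
    unfolding J_def using fn inj
    by (subst select_rows_eq_mult[of _ n k]) (auto simp: select_rows_def)
  show "transpose_mat J * J = diag_indicator n S"
  proof (rule eq_matI)
    fix i j assume "i < dim_row (diag_indicator n S)" "j < dim_col (diag_indicator n S)"
    then have ij: "i < n" "j < n" by (auto simp: diag_indicator_def mat_diag_def)
    have "(transpose_mat J * J) $$ (i, j)
      = (\<Sum>a\<in>{0..<k}. (if f a = i then 1 else 0) * (if f a = j then 1 else 0))"
      using ij J fn by (auto simp: scalar_prod_def J_def intro!: sum.cong)
    also have "\<dots> = (\<Sum>s\<in>S. (if s = i then 1 else 0) * (if s = j then 1 else 0))"
      by (rule sum.reindex_bij_betw[OF f])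
    also have "\<dots> = (\<Sum>s\<in>S. if s = i then (if i = j then 1 else 0) else 0)"
      by (intro sum.cong) auto
    also have "\<dots> = diag_indicator n S $$ (i, j)"
      using ij finite_subset[OF S] by (auto simp: diag_indicator_def mat_diag_def)
    finally show "(transpose_mat J * J) $$ (i, j) = diag_indicator n S $$ (i, j)" .
  qed (use J in \<open>auto simp: diag_indicator_def mat_diag_def\<close>)
qed

text \<open>The masked matrix is the transpose of \<open>?J\<close> times the invertible selected
  block. Hence \<open>?B\<close> is a left inverse, and the product in the other order is the
  symmetric coordinate projection, which yields the Penrose conditions.\<close>

lemma pseudoinverse_diag_indicator:
  assumes X: "X \<in> carrier_mat n d" and f: "bij_betw f {0..<d} S" and S: "S \<subseteq> {0..<n}"
    and Y: "Y \<in> carrier_mat d d" "select_rows d f X * Y = 1\<^sub>m d" "Y * select_rows d f X = 1\<^sub>m d"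
  shows "pseudoinverse (diag_indicator n S * X) = Y * select_rows d f (1\<^sub>m n)"
proof (rule pseudoinverse_eqI)
  let ?J = "select_rows d f (1\<^sub>m n) :: real mat" and ?X = "select_rows d f X"
  let ?A = "diag_indicator n S * X" and ?B = "Y * ?J"
  have J: "?J \<in> carrier_mat d n" "transpose_mat ?J \<in> carrier_mat n d" by simp_all
  have Xf: "?X \<in> carrier_mat d d" using X by simp
  note orth = select_rows_one_orthonormal[OF f S]
  have fn: "f i < n" if "i < d" for i using subsetD[OF S bij_betw_apply[OF f, of i]] that by simp
  have A: "?A = transpose_mat ?J * ?X"
    unfolding orth(2)[symmetric] using assoc_mult_mat[OF J(2,1) X] select_rows_eq_mult[OF X fn] by simp
  have dims: "?A \<in> carrier_mat n d" "?B \<in> carrier_mat d n"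
    unfolding A using J Xf Y by auto
  have "?A * ?B = transpose_mat ?J * (?X * ?B)"
    unfolding A by (rule assoc_mult_mat[OF J(2) Xf dims(2)])
  also have "?X * ?B = ?X * Y * ?J" using assoc_mult_mat[OF Xf Y(1) J(1)] by simp
  finally have AB: "?A * ?B = transpose_mat ?J * ?J" using Y(2) J by simp
  have "?B * ?A = Y * (?J * ?A)"
    by (rule assoc_mult_mat[OF Y(1) J(1) dims(1)])
  also have "?J * ?A = ?J * transpose_mat ?J * ?X"
    unfolding A using assoc_mult_mat[OF J(1,2) Xf] by simp
  finally have BA: "?B * ?A = 1\<^sub>m d" using orth(1) Y(3) Xf by simp
  have "?A * ?B * ?A = ?A * (?B * ?A)" by (rule assoc_mult_mat[OF dims(1,2,1)])
  then have 1: "?A * ?B * ?A = ?A" unfolding BA by (simp only: right_mult_one_mat[OF dims(1)])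
  have 2: "?B * ?A * ?B = ?B" unfolding BA by (rule left_mult_one_mat[OF dims(2)])
  have 3: "transpose_mat (?A * ?B) = ?A * ?B"
    unfolding AB using transpose_mult[OF J(2,1)] by simp
  have "?B \<in> carrier_mat (dim_col ?A) (dim_row ?A)"
    unfolding carrier_matD[OF dims(1)] by (rule dims(2))
  then show "is_pseudoinverse ?A ?B"
    unfolding is_pseudoinverse_def using 1 2 3 by (simp add: BA)
qed

section \<open>Counting injective tuples, full rank and bilinear forms\<close>

lemma card_inj_on_PiE:
  assumes "finite S" "card S = k"
  shows "card {f \<in> {0..<k} \<rightarrow>\<^sub>E S. inj_on f {0..<k}} = fact k"
  using card_inj_on_subset_funcset[of "{0..<k}" S "{0..<k}"] assms by (simp add: fact_prod_rev)

text \<open>If the Gram matrix kills \<open>v\<close>, the squared norm of the image of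
  \<open>v\<close> under \<open>X\<close> is zero, which contradicts independence of the
  columns.\<close>

lemma det_gram_full_rank:
  assumes X: "X \<in> carrier_mat n d" and rank: "vec_space.rank n X = d"
  shows "det (gram X) \<noteq> 0"
proof
  interpret vec_space "TYPE(real)" n .
  assume "det (gram X) = 0"
  then obtain v where v: "v \<in> carrier_vec d" "v \<noteq> 0\<^sub>v d" "gram X *\<^sub>v v = 0\<^sub>v d"
    using det_0_iff_vec_prod_zero_field[of "gram X" d] X by auto
  have Xv: "X *\<^sub>v v \<in> carrier_vec n" using X v(1) by (rule mult_mat_vec_carrier)
  have "(X *\<^sub>v v) \<bullet> (X *\<^sub>v v) = v \<bullet> (gram X *\<^sub>v v)"
    unfolding gram_def using X v(1) Xv transpose_vec_mult_scalar[OF X v(1) Xv]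
      comm_scalar_prod[of "transpose_mat X *\<^sub>v (X *\<^sub>v v)" d v] by simp
  then have "(X *\<^sub>v v) \<bullet> (X *\<^sub>v v) = 0" using v by simp
  then have "(\<Sum>i\<in>{0..<n}. ((X *\<^sub>v v) $ i)\<^sup>2) = 0"
    using X by (simp add: scalar_prod_def power2_eq_square)
  then have "\<forall>i<n. (X *\<^sub>v v) $ i = 0"
    by (subst (asm) sum_nonneg_eq_0_iff) auto
  then have "X *\<^sub>v v = 0\<^sub>v n" using X by (intro eq_vecI) auto
  \<comment> \<open>Passing from full rank to independent columns requires the columns to be
    distinct. A maximal independent set of columns has \<open>d\<close> elements, so none of the
    \<open>d\<close> columns repeats.\<close>
  moreover obtain T where T: "maximal T (\<lambda>T. T \<subseteq> set (cols X) \<and> lin_indpt T)"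
    using maximal_exists_superset[of "set (cols X)" "\<lambda>T. T \<subseteq> set (cols X) \<and> lin_indpt T" "{}"]
    by (auto simp: lin_dep_def)
  then have "card T = d" "T \<subseteq> set (cols X)"
    using rank_card_indpt[OF X T] rank by (auto simp: maximal_def)
  then have "d \<le> card (set (cols X))" using card_mono[of "set (cols X)" T] by simp
  then have dist: "distinct (cols X)"
    using X card_length[of "cols X"] by (intro card_distinct) simp
  ultimately show False
    using lin_depI[OF X v(1,2)] full_rank_lin_indpt[OF X rank dist] dist by simp
qed

lemma scalar_prod_mult_mat_vec:
  fixes A :: "real mat"
  assumes "v \<in> carrier_vec m" "A \<in> carrier_mat m k" "w \<in> carrier_vec k"
  shows "v \<bullet> (A *\<^sub>v w) = (\<Sum>i\<in>{0..<m}. \<Sum>j\<in>{0..<k}. v $ i * A $$ (i, j) * w $ j)"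
  using assms by (auto simp: scalar_prod_def sum_distrib_left mult_ac intro!: sum.cong)

section \<open>Volume sampling as a weighted sum over tuples\<close>

locale full_column_rank =
  fixes X :: "real mat" and n d :: nat
  assumes X: "X \<in> carrier_mat n d" and det_gram: "det (gram X) \<noteq> 0"
begin

abbreviation tuples :: "(nat \<Rightarrow> nat) set" where
  "tuples \<equiv> {0..<d} \<rightarrow>\<^sub>E {0..<n}"

abbreviation minor :: "(nat \<Rightarrow> nat) \<Rightarrow> real" where
  "minor f \<equiv> det (select_rows d f X)"

abbreviation pinv :: "nat set \<Rightarrow> real mat" where
  "pinv S \<equiv> pseudoinverse (diag_indicator n S * X)"

abbreviation subsets :: "nat set set" where
  "subsets \<equiv> {S. S \<subseteq> {0..<n} \<and> card S = d}"

lemma finite_tuples: "finite tuples"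
  by (intro finite_PiE) auto

lemma finite_subsets: "finite subsets"
  by (rule finite_subset[of _ "Pow {0..<n}"]) auto

text \<open>Cauchy-Binet with both factors equal to \<open>X\<close>; this is the normalising
  constant of the tuple weights.\<close>

lemma sum_minor_squared: "(\<Sum>f\<in>tuples. (minor f)\<^sup>2) = fact d * det (gram X)"
  using cauchy_binet_functions[OF X X] by (simp add: power2_eq_square gram_def)

lemma det_gram_pos: "det (gram X) > 0"
proof -
  have "0 \<le> (fact d :: real) * det (gram X)"
    unfolding sum_minor_squared[symmetric] by (simp add: sum_nonneg)
  then have "0 \<le> det (gram X)" using fact_gt_zero[of d, where 'a = real] by (auto simp: zero_le_mult_iff)
  with det_gram show ?thesis by simp
qed

lemma minor_nonzero_bij_betw:
  assumes "f \<in> tuples" "minor f \<noteq> 0"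
  shows "bij_betw f {0..<d} (f ` {0..<d})" "f ` {0..<d} \<in> subsets"
proof -
  have "inj_on f {0..<d}" using det_select_rows_not_inj[OF X, of f] assms(2) by blast
  then show "bij_betw f {0..<d} (f ` {0..<d})" "f ` {0..<d} \<in> subsets"
    using assms(1) by (auto simp: bij_betw_def card_image)
qed

text \<open>Tuples that repeat an index have minor zero. Every \<open>d\<close>-element set is the
  image of \<open>fact d\<close> injective tuples, and the squared minor of each is the Gram
  determinant of that set.\<close>

lemma sum_subsets_eq_sum_tuples:
  fixes \<phi> :: "nat set \<Rightarrow> real"
  shows "fact d * (\<Sum>S\<in>subsets. det (gram (row_submatrix X S)) * \<phi> S)
    = (\<Sum>f\<in>tuples. (minor f)\<^sup>2 * \<phi> (f ` {0..<d}))"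
proof -
  let ?g = "\<lambda>f. (minor f)\<^sup>2 * \<phi> (f ` {0..<d})"
  let ?I = "{f \<in> tuples. inj_on f {0..<d}}"
  have "(\<Sum>f\<in>tuples. ?g f) = (\<Sum>f\<in>?I. ?g f)"
    using det_select_rows_not_inj[OF X]
    by (intro sum.mono_neutral_right finite_tuples) auto
  also have "\<dots> = (\<Sum>S\<in>subsets. \<Sum>f\<in>{f \<in> ?I. f ` {0..<d} = S}. ?g f)"
    using finite_tuples finite_subsets
    by (intro sum.group[symmetric]) (auto simp: card_image)
  also have "\<dots> = (\<Sum>S\<in>subsets. fact d * (det (gram (row_submatrix X S)) * \<phi> S))"
  proof (rule sum.cong[OF refl])
    fix S assume S: "S \<in> subsets"
    then have finS: "finite S" using finite_subset by blast
    \<comment> \<open>An injective map from \<open>d\<close> positions into a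
      \<open>d\<close>-element set is onto, so the fibre over \<open>S\<close> consists of all
      injective maps into \<open>S\<close>.\<close>
    have eq: "{f \<in> ?I. f ` {0..<d} = S} = {f \<in> {0..<d} \<rightarrow>\<^sub>E S. inj_on f {0..<d}}"
    proof -
      have "f ` {0..<d} = S" if "f \<in> {0..<d} \<rightarrow>\<^sub>E S" "inj_on f {0..<d}" for f
        using that S finS by (intro card_subset_eq) (auto simp: card_image)
      then show ?thesis using S by (auto simp: PiE_iff)
    qed
    have "?g f = det (gram (row_submatrix X S)) * \<phi> S" if "f \<in> {f \<in> ?I. f ` {0..<d} = S}" for f
      using that det_gram_row_submatrix[OF X, of S f] S by (auto simp: bij_betw_def)
    then have "(\<Sum>f\<in>{f \<in> ?I. f ` {0..<d} = S}. ?g f)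
        = (\<Sum>f\<in>{f \<in> ?I. f ` {0..<d} = S}. det (gram (row_submatrix X S)) * \<phi> S)"
      by (rule sum.cong[OF refl])
    also have "\<dots> = fact d * (det (gram (row_submatrix X S)) * \<phi> S)"
      unfolding eq using card_inj_on_PiE[OF finS, of d] S by simp
    finally show "(\<Sum>f\<in>{f \<in> ?I. f ` {0..<d} = S}. ?g f)
      = fact d * (det (gram (row_submatrix X S)) * \<phi> S)" .
  qed
  finally show ?thesis by (simp add: sum_distrib_left)
qed

lemma det_gram_row_submatrix_nonneg: "S \<in> subsets \<Longrightarrow> det (gram (row_submatrix X S)) \<ge> 0"
  using det_gram_row_submatrix[OF X, of S "pick S"] bij_betw_pick[of S] finite_subset[of S "{0..<n}"]
  by auto

text \<open>\<open>embed_pmf\<close> has the prescribed values once the weights are nonnegative and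
  sum to one; the sum is the tuple identity for the constant function one, with
  \<open>fact d\<close> cancelled.\<close>

lemma pmf_volume_sampling:
  "pmf (volume_sampling X) S = (if S \<in> subsets then det (gram (row_submatrix X S)) / det (gram X) else 0)"
proof -
  let ?p = "\<lambda>S. if S \<subseteq> {0..<dim_row X} \<and> card S = dim_col X
     then det (gram (row_submatrix X S)) / det (gram X) else 0"
  have dims: "dim_row X = n" "dim_col X = d" using X by auto
  have nonneg: "?p S \<ge> 0" for S
    using det_gram_row_submatrix_nonneg[of S] det_gram_pos dims by auto
  have "fact d * (\<Sum>S\<in>subsets. det (gram (row_submatrix X S))) = fact d * det (gram X)"
    using sum_subsets_eq_sum_tuples[of "\<lambda>_. 1"] sum_minor_squared by simp
  then have "(\<Sum>S\<in>subsets. ?p S) = 1"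
    using det_gram_pos dims by (simp add: sum_divide_distrib[symmetric])
  moreover have "(\<integral>\<^sup>+S. ennreal (?p S) \<partial>count_space UNIV) = ennreal (\<Sum>S\<in>subsets. ?p S)"
    unfolding sum_ennreal[OF nonneg, symmetric] using finite_subsets dims
    by (subst nn_integral_count_space'[of subsets]) auto
  ultimately have "(\<integral>\<^sup>+S. ennreal (?p S) \<partial>count_space UNIV) = 1" by simp
  then have "pmf (volume_sampling X) S = ?p S"
    unfolding volume_sampling_def by (intro pmf_embed_pmf nonneg)
  then show ?thesis using dims by simp
qed

text \<open>Tuples with zero minor get weight zero, so the integrand only has to be understood where
  the selected block is invertible.\<close>

lemma expectation_volume_sampling:
  fixes \<phi> :: "nat set \<Rightarrow> real"
  shows "fact d * det (gram X) * measure_pmf.expectation (volume_sampling X) \<phi>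
    = (\<Sum>f\<in>tuples. (minor f)\<^sup>2 * \<phi> (f ` {0..<d}))"
proof -
  have "measure_pmf.expectation (volume_sampling X) \<phi>
      = (\<Sum>S\<in>subsets. \<phi> S * pmf (volume_sampling X) S)"
    by (rule integral_measure_pmf_real[OF finite_subsets])
      (simp add: set_pmf_eq pmf_volume_sampling split: if_splits)
  also have "\<dots> = (\<Sum>S\<in>subsets. det (gram (row_submatrix X S)) * \<phi> S) / det (gram X)"
    by (simp add: pmf_volume_sampling sum_divide_distrib mult.commute)
  finally show ?thesis
    using det_gram_pos sum_subsets_eq_sum_tuples[of \<phi>] by simp
qed

section \<open>Interpolation on the sample and residuals as minors\<close>

text \<open>The pseudoinverse restricts \<open>v\<close> to the selected rows and then inverts the
  selected block, so the fit is exact on those rows.\<close>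

lemma pinv_solves:
  assumes f: "f \<in> tuples" "minor f \<noteq> 0"
  shows pinv_carrier: "pinv (f ` {0..<d}) \<in> carrier_mat d n"
    and select_rows_pinv: "v \<in> carrier_vec n \<Longrightarrow>
      select_rows d f X *\<^sub>v (pinv (f ` {0..<d}) *\<^sub>v v) = vec d (\<lambda>a. v $ f a)"
proof -
  have Xf: "select_rows d f X \<in> carrier_mat d d" using X by simp
  obtain Y where Y: "Y \<in> carrier_mat d d" "select_rows d f X * Y = 1\<^sub>m d" "Y * select_rows d f X = 1\<^sub>m d"
    using obtain_inverse_mat[OF Xf f(2)] by blast
  have pinv: "pinv (f ` {0..<d}) = Y * select_rows d f (1\<^sub>m n)"
    using minor_nonzero_bij_betw[OF f] Y by (intro pseudoinverse_diag_indicator[OF X]) auto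
  then show "pinv (f ` {0..<d}) \<in> carrier_mat d n" using Y by simp
  assume v: "v \<in> carrier_vec n"
  let ?J = "select_rows d f (1\<^sub>m n) :: real mat"
  have J: "?J \<in> carrier_mat d n" by simp
  have Jv: "?J *\<^sub>v v \<in> carrier_vec d" using J v by (rule mult_mat_vec_carrier)
  have "select_rows d f X *\<^sub>v (Y * ?J *\<^sub>v v) = (select_rows d f X * Y) *\<^sub>v (?J *\<^sub>v v)"
    unfolding assoc_mult_mat_vec[OF Y(1) J v] assoc_mult_mat_vec[OF Xf Y(1) Jv] ..
  also have "\<dots> = ?J *\<^sub>v v" using Y(2) Jv by simp
  also have "\<dots> = vec d (\<lambda>a. v $ f a)"
    using f(1) by (intro select_rows_one_mult_vec[OF v]) auto
  finally show "select_rows d f X *\<^sub>v (pinv (f ` {0..<d}) *\<^sub>v v) = vec d (\<lambda>a. v $ f a)"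
    unfolding pinv .
qed

definition augment :: "real vec \<Rightarrow> real mat" where
  "augment v = mat n (Suc d) (\<lambda>(i, j). if j < d then X $$ (i, j) else v $ i)"

lemma augment_carrier [simp]: "augment v \<in> carrier_mat n (Suc d)"
  by (simp add: augment_def)

text \<open>The selected block is bordered by row \<open>k\<close> at position \<open>d\<close> and
  by the response. Interpolation supplies the solution for the border column, and the Schur
  complement is the residual at \<open>k\<close>.\<close>

lemma det_select_rows_augment:
  assumes f: "f \<in> tuples" "minor f \<noteq> 0" and v: "v \<in> carrier_vec n" and k: "k < n"
  shows "det (select_rows (Suc d) (f(d := k)) (augment v))
    = minor f * (v $ k - (X *\<^sub>v (pinv (f ` {0..<d}) *\<^sub>v v)) $ k)"
proof -
  let ?y = "pinv (f ` {0..<d}) *\<^sub>v v" and ?b = "vec d (\<lambda>a. v $ f a)"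
  have fn: "f i < n" if "i < d" for i using f(1) that by auto
  have Xf: "select_rows d f X \<in> carrier_mat d d" using X by simp
  have y: "?y \<in> carrier_vec d" using pinv_carrier[OF f] v by (rule mult_mat_vec_carrier)
  have "select_rows (Suc d) (f(d := k)) (augment v) = four_block_mat (select_rows d f X)
      (mat d 1 (\<lambda>(i, _). ?b $ i)) (mat 1 d (\<lambda>(_, j). row X k $ j)) (mat 1 1 (\<lambda>_. v $ k))"
    using X k fn by (intro eq_matI) (auto simp: augment_def less_Suc_eq)
  then show ?thesis
    using det_bordered[OF Xf y, of "row X k" ?b "v $ k"] select_rows_pinv[OF f v] X k by simp
qed

section \<open>Full least squares and the projection\<close>

definition gram_inv :: "real mat" where
  "gram_inv = the (mat_inverse (gram X))"

lemma gram_inv: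
  "gram_inv \<in> carrier_mat d d" "gram X * gram_inv = 1\<^sub>m d"
proof -
  have G: "gram X \<in> carrier_mat d d" using X by simp
  have "gram X \<in> Units (ring_mat TYPE(real) d ())"
    by (rule det_non_zero_imp_unit[OF G det_gram])
  \<comment> \<open>\<open>mat_inverse\<close> returns \<open>None\<close> only for a non-unit, so
    \<open>the\<close> is applied to an actual inverse.\<close>
  then obtain B where "mat_inverse (gram X) = Some B"
    using mat_inverse(1)[OF G, where b = "()"] by fastforce
  then show "gram_inv \<in> carrier_mat d d" "gram X * gram_inv = 1\<^sub>m d"
    using mat_inverse(2)[OF G] by (auto simp: gram_inv_def)
qed

lemma proj_col_span_eq: "proj_col_span X = X * gram_inv * transpose_mat X"
  by (simp add: proj_col_span_def gram_inv_def)

lemma proj_col_span_carrier: "proj_col_span X \<in> carrier_mat n n"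
  unfolding proj_col_span_eq using X gram_inv(1) by auto

text \<open>The least squares coefficients of \<open>v\<close> on all rows, that is, the solution of
  the normal equations.\<close>

definition coeffs :: "real vec \<Rightarrow> real vec" where
  "coeffs v = gram_inv *\<^sub>v (transpose_mat X *\<^sub>v v)"

lemma transpose_mult_carrier: "v \<in> carrier_vec n \<Longrightarrow> transpose_mat X *\<^sub>v v \<in> carrier_vec d"
  using X by (intro mult_mat_vec_carrier) auto

lemma coeffs_carrier: "v \<in> carrier_vec n \<Longrightarrow> coeffs v \<in> carrier_vec d"
  unfolding coeffs_def by (rule mult_mat_vec_carrier[OF gram_inv(1) transpose_mult_carrier])

lemma gram_mult_coeffs:
  assumes "v \<in> carrier_vec n"
  shows "gram X *\<^sub>v coeffs v = transpose_mat X *\<^sub>v v"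
  unfolding coeffs_def
  using assoc_mult_mat_vec[OF _ gram_inv(1) transpose_mult_carrier[OF assms], of "gram X" d]
    X gram_inv(2) transpose_mult_carrier[OF assms] by simp

lemma proj_col_span_mult_vec:
  assumes v: "v \<in> carrier_vec n"
  shows "proj_col_span X *\<^sub>v v = X *\<^sub>v coeffs v"
proof -
  have Xt: "transpose_mat X \<in> carrier_mat d n" using X by simp
  have "X * gram_inv \<in> carrier_mat n d" using X gram_inv(1) by simp
  from assoc_mult_mat_vec[OF this Xt v]
  show ?thesis
    unfolding proj_col_span_eq coeffs_def
    using assoc_mult_mat_vec[OF X gram_inv(1) transpose_mult_carrier[OF v]] by simp
qed

lemma scalar_prod_X:
  assumes "v \<in> carrier_vec n" "h \<in> carrier_vec d"
  shows "(transpose_mat X *\<^sub>v v) \<bullet> h = v \<bullet> (X *\<^sub>v h)"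
  by (rule transpose_vec_mult_scalar[OF X assms(2,1)])

text \<open>The product is the Gram matrix of \<open>X\<close> with a border of width one. The
  normal equations solve for the border column, and the Schur complement is the inner product of
  \<open>v\<close> with the least squares residual of \<open>w\<close>.\<close>

lemma det_gram_augment:
  assumes v: "v \<in> carrier_vec n" and w: "w \<in> carrier_vec n"
  shows "det (transpose_mat (augment v) * augment w)
    = det (gram X) * (v \<bullet> w - v \<bullet> (proj_col_span X *\<^sub>v w))"
proof -
  let ?b = "transpose_mat X *\<^sub>v w" and ?c = "transpose_mat X *\<^sub>v v"
  have cols: "col (augment u) j = (if j < d then col X j else u)"
    if "u \<in> carrier_vec n" "j < Suc d" for u j
    using that X by (intro eq_vecI) (auto simp: augment_def)
  have "transpose_mat (augment v) * augment w = four_block_mat (gram X)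
      (mat d 1 (\<lambda>(i, _). ?b $ i)) (mat 1 d (\<lambda>(_, j). ?c $ j)) (mat 1 1 (\<lambda>_. v \<bullet> w))"
  proof (rule eq_matI)
    let ?M = "four_block_mat (gram X)
      (mat d 1 (\<lambda>(i, _). ?b $ i)) (mat 1 d (\<lambda>(_, j). ?c $ j)) (mat 1 1 (\<lambda>_. v \<bullet> w))"
    have G: "dim_row (gram X) = d" "dim_col (gram X) = d" using X by (auto simp: gram_def)
    fix i j assume "i < dim_row ?M" "j < dim_col ?M"
    then have ij: "i < Suc d" "j < Suc d" using G by auto
    have aug: "dim_row (augment u) = n" "dim_col (augment u) = Suc d" for u
      using augment_carrier[of u] by (simp_all only: carrier_matD)
    have "(transpose_mat (augment v) * augment w) $$ (i, j) = col (augment v) i \<bullet> col (augment w) j"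
      using ij aug by simp
    also have "\<dots> = ?M $$ (i, j)"
      using ij G X v w comm_scalar_prod[of v n "col X j"]
      by (auto simp: cols gram_def less_Suc_eq)
    finally show "(transpose_mat (augment v) * augment w) $$ (i, j) = ?M $$ (i, j)" .
  qed (use X in \<open>auto simp: augment_def gram_def\<close>)
  moreover have "gram X \<in> carrier_mat d d" using X by simp
  ultimately show ?thesis
    using det_bordered[OF _ coeffs_carrier[OF w] transpose_mult_carrier[OF v] gram_mult_coeffs[OF w], of "v \<bullet> w"]
      scalar_prod_X[OF v coeffs_carrier[OF w]] proj_col_span_mult_vec[OF w] by simp
qed

text \<open>The transpose is a left inverse of the symmetric Gram matrix, and a left inverse agrees
  with a right inverse.\<close>

lemma gram_inv_symmetric: "transpose_mat gram_inv = gram_inv"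
proof -
  have G: "gram X \<in> carrier_mat d d" using X by simp
  have Gt: "transpose_mat (gram X) = gram X"
    using transpose_mult[of "transpose_mat X" d n X d] X by (simp add: gram_def)
  have It: "transpose_mat gram_inv \<in> carrier_mat d d" using gram_inv(1) by simp
  have inv: "transpose_mat gram_inv * gram X = 1\<^sub>m d"
    using transpose_mult[OF G gram_inv(1)] Gt gram_inv(2) by simp
  have "transpose_mat gram_inv = transpose_mat gram_inv * (gram X * gram_inv)"
    unfolding gram_inv(2) using It by (simp only: right_mult_one_mat)
  also have "\<dots> = transpose_mat gram_inv * gram X * gram_inv"
    by (rule assoc_mult_mat[OF It G gram_inv(1), symmetric])
  also have "\<dots> = gram_inv" unfolding inv by (rule left_mult_one_mat[OF gram_inv(1)])
  finally show ?thesis .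
qed

text \<open>Makes the two cross terms in the expanded product of residuals equal.\<close>

lemma proj_col_span_sym:
  assumes v: "v \<in> carrier_vec n" and w: "w \<in> carrier_vec n"
  shows "v \<bullet> (proj_col_span X *\<^sub>v w) = w \<bullet> (proj_col_span X *\<^sub>v v)"
proof -
  let ?v = "transpose_mat X *\<^sub>v v" and ?w = "transpose_mat X *\<^sub>v w"
  note cv = transpose_mult_carrier[OF v] and cw = transpose_mult_carrier[OF w]
  have "v \<bullet> (proj_col_span X *\<^sub>v w) = ?v \<bullet> (gram_inv *\<^sub>v ?w)"
    using proj_col_span_mult_vec[OF w] scalar_prod_X[OF v coeffs_carrier[OF w]] by (simp only: coeffs_def)
  also have "\<dots> = (gram_inv *\<^sub>v ?v) \<bullet> ?w"
    using transpose_vec_mult_scalar[OF gram_inv(1) cw cv] gram_inv_symmetric by simp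
  also have "\<dots> = ?w \<bullet> coeffs v"
    unfolding coeffs_def by (rule comm_scalar_prod[OF mult_mat_vec_carrier[OF gram_inv(1) cv] cw])
  also have "\<dots> = w \<bullet> (proj_col_span X *\<^sub>v v)"
    unfolding proj_col_span_mult_vec[OF v] by (rule scalar_prod_X[OF w coeffs_carrier[OF v]])
  finally show ?thesis .
qed

text \<open>Least squares on a volume sampled row set is unbiased: by Cramer's rule both sides are
  determinants of \<open>X\<close> with column \<open>c\<close> replaced by \<open>w\<close>, matched by the Cauchy--Binet formula.\<close>

lemma sum_minor_squared_pinv:
  assumes w: "w \<in> carrier_vec n" and c: "c < d"
  shows "(\<Sum>f\<in>tuples. (minor f)\<^sup>2 * (pinv (f ` {0..<d}) *\<^sub>v w) $ c)
    = fact d * det (gram X) * coeffs w $ c"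
proof -
  let ?R = "replace_col X w c"
  have R: "?R \<in> carrier_mat n d" using X by (simp add: replace_col_def)
  have "(minor f)\<^sup>2 * (pinv (f ` {0..<d}) *\<^sub>v w) $ c = minor f * det (select_rows d f ?R)"
    if f: "f \<in> tuples" for f
  proof (cases "minor f = 0")
    case False
    have Xf: "select_rows d f X \<in> carrier_mat d d" using X by simp
    have h: "pinv (f ` {0..<d}) *\<^sub>v w \<in> carrier_vec d"
      using pinv_carrier[OF f False] w by (rule mult_mat_vec_carrier)
    have "f i < n" if "i < d" for i using f that by auto
    then have "select_rows d f ?R = replace_col (select_rows d f X) (vec d (\<lambda>a. w $ f a)) c"
      using X by (intro eq_matI) (auto simp: replace_col_def)
    then show ?thesis
      using cramer_lemma_mat[OF Xf h c] select_rows_pinv[OF f False w]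
      by (simp add: power2_eq_square)
  qed simp
  then have "(\<Sum>f\<in>tuples. (minor f)\<^sup>2 * (pinv (f ` {0..<d}) *\<^sub>v w) $ c)
      = (\<Sum>f\<in>tuples. minor f * det (select_rows d f ?R))"
    by (rule sum.cong[OF refl])
  also have "\<dots> = fact d * det (transpose_mat X * ?R)"
    using cauchy_binet_functions[OF X R] by simp
  \<comment> \<open>By the normal equations the replaced column is the Gram matrix applied to
    \<open>coeffs w\<close>, so Cramer's rule can be read backwards.\<close>
  also have "transpose_mat X * ?R = replace_col (gram X) (gram X *\<^sub>v coeffs w) c"
    unfolding gram_mult_coeffs[OF w] using X w
    by (intro eq_matI) (auto simp: replace_col_def gram_def scalar_prod_def intro!: sum.cong)
  also have "det \<dots> = coeffs w $ c * det (gram X)"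
    using X by (intro cramer_lemma_mat[OF _ coeffs_carrier[OF w] c]) simp
  finally show ?thesis by simp
qed

text \<open>Moving \<open>X\<close> to the side of \<open>v\<close> leaves a fixed linear form in
  the sampled coefficients, to which unbiasedness applies coordinate by coordinate.\<close>

lemma sum_minor_squared_scalar_prod:
  assumes v: "v \<in> carrier_vec n" and w: "w \<in> carrier_vec n"
  shows "(\<Sum>f\<in>tuples. (minor f)\<^sup>2 * (v \<bullet> (X *\<^sub>v (pinv (f ` {0..<d}) *\<^sub>v w))))
    = fact d * det (gram X) * (v \<bullet> (proj_col_span X *\<^sub>v w))"
proof -
  let ?u = "transpose_mat X *\<^sub>v v" and ?h = "\<lambda>f. pinv (f ` {0..<d}) *\<^sub>v w"
  have "(minor f)\<^sup>2 * (v \<bullet> (X *\<^sub>v ?h f)) = (\<Sum>c\<in>{0..<d}. ?u $ c * ((minor f)\<^sup>2 * ?h f $ c))"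
    if f: "f \<in> tuples" for f
  proof (cases "minor f = 0")
    case False
    have h: "?h f \<in> carrier_vec d"
      using pinv_carrier[OF f False] w by (rule mult_mat_vec_carrier)
    have "?u \<bullet> ?h f = (\<Sum>c\<in>{0..<d}. ?u $ c * ?h f $ c)"
      unfolding scalar_prod_def carrier_vecD[OF h] ..
    then show ?thesis
      unfolding scalar_prod_X[OF v h] by (simp only: sum_distrib_left mult_ac)
  qed simp
  then have "(\<Sum>f\<in>tuples. (minor f)\<^sup>2 * (v \<bullet> (X *\<^sub>v ?h f)))
      = (\<Sum>f\<in>tuples. \<Sum>c\<in>{0..<d}. ?u $ c * ((minor f)\<^sup>2 * ?h f $ c))"
    by (rule sum.cong[OF refl])
  also have "\<dots> = (\<Sum>c\<in>{0..<d}. ?u $ c * (\<Sum>f\<in>tuples. (minor f)\<^sup>2 * ?h f $ c))"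
    unfolding sum_distrib_left by (rule sum.swap)
  also have "\<dots> = (\<Sum>c\<in>{0..<d}. ?u $ c * (fact d * det (gram X) * coeffs w $ c))"
    using sum_minor_squared_pinv[OF w] by simp
  also have "\<dots> = fact d * det (gram X) * (?u \<bullet> coeffs w)"
    unfolding scalar_prod_def using coeffs_carrier[OF w] by (simp add: sum_distrib_left mult_ac)
  finally show ?thesis
    unfolding scalar_prod_X[OF v coeffs_carrier[OF w]] proj_col_span_mult_vec[OF w] .
qed

section \<open>Products of residuals summed over tuples\<close>

text \<open>Since tuples are extensional, the pairs \<open>(k, f)\<close> correspond bijectively to
  tuples of length \<open>Suc d\<close>, and Cauchy-Binet applies to the augmented matrices. The
  factor \<open>Suc d\<close> in the factorial is the source of the factor \<open>d\<close> in the
  result.\<close>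

lemma sum_det_augment:
  assumes v: "v \<in> carrier_vec n" and w: "w \<in> carrier_vec n"
  shows "(\<Sum>f\<in>tuples. \<Sum>k\<in>{0..<n}. det (select_rows (Suc d) (f(d := k)) (augment v))
        * det (select_rows (Suc d) (f(d := k)) (augment w)))
    = fact (Suc d) * det (gram X) * (v \<bullet> w - v \<bullet> (proj_col_span X *\<^sub>v w))"
proof -
  let ?D = "\<lambda>g. det (select_rows (Suc d) g (augment v)) * det (select_rows (Suc d) g (augment w))"
  have "(\<Sum>f\<in>tuples. \<Sum>k\<in>{0..<n}. ?D (f(d := k))) = (\<Sum>(k, f)\<in>{0..<n} \<times> tuples. ?D (f(d := k)))"
    by (subst sum.swap) (simp add: sum.cartesian_product)
  also have "\<dots> = (\<Sum>g\<in>(\<lambda>(k, f). f(d := k)) ` ({0..<n} \<times> tuples). ?D g)"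
    using inj_combinator[of d "{0..<d}" "\<lambda>_. {0..<n}"]
    by (subst sum.reindex) (auto simp: case_prod_unfold)
  also have "(\<lambda>(k, f). f(d := k)) ` ({0..<n} \<times> tuples) = {0..<Suc d} \<rightarrow>\<^sub>E {0..<n}"
    by (simp add: PiE_insert_eq atLeast0_lessThan_Suc)
  also have "(\<Sum>g\<in>{0..<Suc d} \<rightarrow>\<^sub>E {0..<n}. ?D g)
      = fact (Suc d) * det (transpose_mat (augment v) * augment w)"
    using cauchy_binet_functions[OF augment_carrier augment_carrier]
    by (simp only: of_nat_fact)
  finally show ?thesis using det_gram_augment[OF v w] by (simp only: mult.assoc)
qed

text \<open>The part of the Cauchy-Binet sum in which the selected block is singular, where minors
  are not residuals of an interpolant.\<close>

definition defect :: "real vec \<Rightarrow> real vec \<Rightarrow> real" where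
  "defect v w = (\<Sum>f\<in>{f \<in> tuples. minor f = 0}. \<Sum>k\<in>{0..<n}.
     det (select_rows (Suc d) (f(d := k)) (augment v))
     * det (select_rows (Suc d) (f(d := k)) (augment w)))"

text \<open>Remove \<open>defect\<close> from the full sum and expand each remaining product of
  residuals into four terms. Three are known from the normalising constant and unbiasedness; solving
  for the fourth gives the claim.\<close>

lemma sum_fitted_scalar_prod:
  assumes v: "v \<in> carrier_vec n" and w: "w \<in> carrier_vec n"
  shows "(\<Sum>f\<in>tuples. (minor f)\<^sup>2 *
      ((X *\<^sub>v (pinv (f ` {0..<d}) *\<^sub>v v)) \<bullet> (X *\<^sub>v (pinv (f ` {0..<d}) *\<^sub>v w))))
    = fact d * det (gram X) * (v \<bullet> (proj_col_span X *\<^sub>v w)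
        + real d * (v \<bullet> w - v \<bullet> (proj_col_span X *\<^sub>v w))) - defect v w"
proof -
  let ?fit = "\<lambda>f u. X *\<^sub>v (pinv (f ` {0..<d}) *\<^sub>v u)"
  let ?D = "\<lambda>f. \<Sum>k\<in>{0..<n}. det (select_rows (Suc d) (f(d := k)) (augment v))
     * det (select_rows (Suc d) (f(d := k)) (augment w))"
  let ?K = "fact d * det (gram X)" and ?p = "v \<bullet> (proj_col_span X *\<^sub>v w)"
  have D: "?D f = (minor f)\<^sup>2 * (v \<bullet> w) - (minor f)\<^sup>2 * (v \<bullet> ?fit f w)
      - (minor f)\<^sup>2 * (w \<bullet> ?fit f v) + (minor f)\<^sup>2 * (?fit f v \<bullet> ?fit f w)"
    if f: "f \<in> tuples" "minor f \<noteq> 0" for f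
  proof -
    have fit: "?fit f u \<in> carrier_vec n" if "u \<in> carrier_vec n" for u
      using mult_mat_vec_carrier[OF X mult_mat_vec_carrier[OF pinv_carrier[OF f] that]] .
    have "?D f = (\<Sum>k\<in>{0..<n}. (minor f)\<^sup>2 * ((v $ k - ?fit f v $ k) * (w $ k - ?fit f w $ k)))"
      using det_select_rows_augment[OF f v] det_select_rows_augment[OF f w]
      by (intro sum.cong refl) (simp add: power2_eq_square)
    also have "\<dots> = (minor f)\<^sup>2 * (\<Sum>k\<in>{0..<n}. v $ k * w $ k - v $ k * ?fit f w $ k
        - w $ k * ?fit f v $ k + ?fit f v $ k * ?fit f w $ k)"
      unfolding sum_distrib_left by (intro sum.cong refl) (simp add: algebra_simps)
    also have "\<dots> = (minor f)\<^sup>2 * (v \<bullet> w - v \<bullet> ?fit f w - w \<bullet> ?fit f v + ?fit f v \<bullet> ?fit f w)"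
      unfolding scalar_prod_def carrier_vecD[OF w] carrier_vecD[OF fit[OF v]] carrier_vecD[OF fit[OF w]]
      by (simp add: sum.distrib sum_subtractf)
    finally show ?thesis by (simp add: algebra_simps)
  qed
  have "fact (Suc d) * det (gram X) * (v \<bullet> w - ?p) = (\<Sum>f\<in>tuples. ?D f)"
    using sum_det_augment[OF v w] by simp
  also have "\<dots> = defect v w + (\<Sum>f\<in>{f \<in> tuples. minor f \<noteq> 0}. ?D f)"
    unfolding defect_def using finite_tuples
    by (subst sum.union_disjoint[symmetric]) (auto intro!: sum.cong)
  also have "(\<Sum>f\<in>{f \<in> tuples. minor f \<noteq> 0}. ?D f)
      = (\<Sum>f\<in>{f \<in> tuples. minor f \<noteq> 0}. (minor f)\<^sup>2 * (v \<bullet> w) - (minor f)\<^sup>2 * (v \<bullet> ?fit f w)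
      - (minor f)\<^sup>2 * (w \<bullet> ?fit f v) + (minor f)\<^sup>2 * (?fit f v \<bullet> ?fit f w))"
    using D by (intro sum.cong) auto
  \<comment> \<open>The tuples added back have minor zero, so every summand vanishes there; the sums
    again range over all of \<open>tuples\<close>, as unbiasedness requires.\<close>
  also have "\<dots> = (\<Sum>f\<in>tuples. (minor f)\<^sup>2 * (v \<bullet> w) - (minor f)\<^sup>2 * (v \<bullet> ?fit f w)
      - (minor f)\<^sup>2 * (w \<bullet> ?fit f v) + (minor f)\<^sup>2 * (?fit f v \<bullet> ?fit f w))"
    using finite_tuples by (intro sum.mono_neutral_left) auto
  also have "\<dots> = (\<Sum>f\<in>tuples. (minor f)\<^sup>2) * (v \<bullet> w)
      - (\<Sum>f\<in>tuples. (minor f)\<^sup>2 * (v \<bullet> ?fit f w)) - (\<Sum>f\<in>tuples. (minor f)\<^sup>2 * (w \<bullet> ?fit f v))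
      + (\<Sum>f\<in>tuples. (minor f)\<^sup>2 * (?fit f v \<bullet> ?fit f w))"
    by (simp only: sum.distrib sum_subtractf sum_distrib_right)
  also have "\<dots> = ?K * (v \<bullet> w) - ?K * ?p - ?K * ?p
      + (\<Sum>f\<in>tuples. (minor f)\<^sup>2 * (?fit f v \<bullet> ?fit f w))"
    unfolding sum_minor_squared sum_minor_squared_scalar_prod[OF v w]
      sum_minor_squared_scalar_prod[OF w v] proj_col_span_sym[OF w v] ..
  finally show ?thesis by (simp add: algebra_simps)
qed

section \<open>The bilinear form of the expected matrix\<close>

abbreviation sampled_cov :: "nat set \<Rightarrow> real mat" where
  "sampled_cov S \<equiv> transpose_mat (pinv S) * transpose_mat X * X * pinv S"

abbreviation expected_cov :: "real mat" where
  "expected_cov \<equiv> expectation_mat n n (volume_sampling X) sampled_cov"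

text \<open>The sampled matrix is the Gram matrix of \<open>X\<close> times the pseudoinverse, so
  its bilinear form is an inner product of fitted vectors.\<close>

lemma scalar_prod_sampled_cov:
  assumes f: "f \<in> tuples" "minor f \<noteq> 0" and v: "v \<in> carrier_vec n" and w: "w \<in> carrier_vec n"
  shows "sampled_cov (f ` {0..<d}) \<in> carrier_mat n n"
    and "v \<bullet> (sampled_cov (f ` {0..<d}) *\<^sub>v w)
      = (X *\<^sub>v (pinv (f ` {0..<d}) *\<^sub>v v)) \<bullet> (X *\<^sub>v (pinv (f ` {0..<d}) *\<^sub>v w))"
proof -
  define H where "H = pinv (f ` {0..<d})"
  have H: "H \<in> carrier_mat d n" unfolding H_def by (rule pinv_carrier[OF f])
  have XH: "X * H \<in> carrier_mat n n" using X H by simp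
  have "transpose_mat H * transpose_mat X = transpose_mat (X * H)"
    by (rule transpose_mult[OF X H, symmetric])
  then have eq: "transpose_mat H * transpose_mat X * X * H = transpose_mat (X * H) * (X * H)"
    using assoc_mult_mat[OF _ X H, of "transpose_mat (X * H)" n] XH by simp
  then show "sampled_cov (f ` {0..<d}) \<in> carrier_mat n n"
    unfolding H_def[symmetric] using XH by simp
  have XHw: "(X * H) *\<^sub>v w \<in> carrier_vec n" using XH w by (rule mult_mat_vec_carrier)
  have XHt: "transpose_mat (X * H) \<in> carrier_mat n n" using XH by simp
  have "v \<bullet> (transpose_mat (X * H) * (X * H) *\<^sub>v w) = v \<bullet> (transpose_mat (X * H) *\<^sub>v ((X * H) *\<^sub>v w))"
    by (simp only: assoc_mult_mat_vec[OF XHt XH w])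
  also have "\<dots> = ((X * H) *\<^sub>v v) \<bullet> ((X * H) *\<^sub>v w)"
    using transpose_vec_mult_scalar[OF XHt XHw v] by simp
  also have "\<dots> = (X *\<^sub>v (H *\<^sub>v v)) \<bullet> (X *\<^sub>v (H *\<^sub>v w))"
    by (simp only: assoc_mult_mat_vec[OF X H v] assoc_mult_mat_vec[OF X H w])
  finally show "v \<bullet> (sampled_cov (f ` {0..<d}) *\<^sub>v w)
      = (X *\<^sub>v (pinv (f ` {0..<d}) *\<^sub>v v)) \<bullet> (X *\<^sub>v (pinv (f ` {0..<d}) *\<^sub>v w))"
    unfolding H_def[symmetric] eq .
qed

lemma expected_cov_carrier: "expected_cov \<in> carrier_mat n n"
  by (simp add: expectation_mat_def)

text \<open>\<open>expectation_mat\<close> acts entrywise: the form is expanded into entries, each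
  entry becomes a tuple sum, and exchanging sums reassembles the form for each tuple.\<close>

lemma scalar_prod_expected_cov:
  assumes v: "v \<in> carrier_vec n" and w: "w \<in> carrier_vec n"
  shows "fact d * det (gram X) * (v \<bullet> (expected_cov *\<^sub>v w))
    = (\<Sum>f\<in>tuples. (minor f)\<^sup>2 *
      ((X *\<^sub>v (pinv (f ` {0..<d}) *\<^sub>v v)) \<bullet> (X *\<^sub>v (pinv (f ` {0..<d}) *\<^sub>v w))))"
proof -
  let ?K = "fact d * det (gram X)" and ?F = "\<lambda>f. sampled_cov (f ` {0..<d})"
  have "?K * (v \<bullet> (expected_cov *\<^sub>v w))
    = (\<Sum>i\<in>{0..<n}. \<Sum>j\<in>{0..<n}. v $ i * w $ j *
        (?K * measure_pmf.expectation (volume_sampling X) (\<lambda>S. sampled_cov S $$ (i, j))))"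
    unfolding scalar_prod_mult_mat_vec[OF v expected_cov_carrier w] sum_distrib_left
    by (intro sum.cong refl) (simp add: expectation_mat_def)
  also have "\<dots> = (\<Sum>i\<in>{0..<n}. \<Sum>j\<in>{0..<n}. \<Sum>f\<in>tuples.
      (minor f)\<^sup>2 * (v $ i * ?F f $$ (i, j) * w $ j))"
    unfolding expectation_volume_sampling sum_distrib_left
    by (intro sum.cong refl) (simp only: mult_ac)
  also have "\<dots> = (\<Sum>i\<in>{0..<n}. \<Sum>f\<in>tuples. \<Sum>j\<in>{0..<n}.
      (minor f)\<^sup>2 * (v $ i * ?F f $$ (i, j) * w $ j))"
    by (intro sum.cong refl) (rule sum.swap)
  also have "\<dots> = (\<Sum>f\<in>tuples. \<Sum>i\<in>{0..<n}. \<Sum>j\<in>{0..<n}.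
      (minor f)\<^sup>2 * (v $ i * ?F f $$ (i, j) * w $ j))"
    by (rule sum.swap)
  also have "\<dots> = (\<Sum>f\<in>tuples. (minor f)\<^sup>2 *
      ((X *\<^sub>v (pinv (f ` {0..<d}) *\<^sub>v v)) \<bullet> (X *\<^sub>v (pinv (f ` {0..<d}) *\<^sub>v w))))"
  proof (rule sum.cong[OF refl])
    fix f assume f: "f \<in> tuples"
    show "(\<Sum>i\<in>{0..<n}. \<Sum>j\<in>{0..<n}. (minor f)\<^sup>2 * (v $ i * ?F f $$ (i, j) * w $ j))
      = (minor f)\<^sup>2 *
      ((X *\<^sub>v (pinv (f ` {0..<d}) *\<^sub>v v)) \<bullet> (X *\<^sub>v (pinv (f ` {0..<d}) *\<^sub>v w)))"
    proof (cases "minor f = 0")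
      case False
      note cov = scalar_prod_sampled_cov[OF f False v w]
      show ?thesis
        unfolding cov(2)[symmetric] scalar_prod_mult_mat_vec[OF v cov(1) w] sum_distrib_left ..
    qed simp
  qed
  finally show ?thesis .
qed

section \<open>The difference of the two sides\<close>

text \<open>Right side minus left side of the claim, so that the order relation becomes
  \<open>psd gap\<close> and equality becomes \<open>gap\<close> being zero.\<close>

definition gap :: "real mat" where
  "gap = real d \<cdot>\<^sub>m (1\<^sub>m n - proj_col_span X) - (expected_cov - proj_col_span X)"

lemma gap_carrier: "gap \<in> carrier_mat n n"
  unfolding gap_def using proj_col_span_carrier by (intro minus_carrier_mat)

text \<open>Subtracting the evaluated expectation cancels all projection terms, and only the omitted
  minors survive.\<close>

lemma scalar_prod_gap:
  assumes v: "v \<in> carrier_vec n" and w: "w \<in> carrier_vec n"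
  shows "fact d * det (gram X) * (v \<bullet> (gap *\<^sub>v w)) = defect v w"
proof -
  let ?P = "proj_col_span X" and ?E = expected_cov
  have P: "?P \<in> carrier_mat n n" and E: "?E \<in> carrier_mat n n"
    by (rule proj_col_span_carrier, rule expected_cov_carrier)
  have Pw: "?P *\<^sub>v w \<in> carrier_vec n" and Ew: "?E *\<^sub>v w \<in> carrier_vec n"
    using P E w by (auto intro: mult_mat_vec_carrier)
  have "gap *\<^sub>v w = real d \<cdot>\<^sub>v (w - ?P *\<^sub>v w) - (?E *\<^sub>v w - ?P *\<^sub>v w)"
  proof (rule eq_vecI)
    fix i assume "i < dim_vec (real d \<cdot>\<^sub>v (w - ?P *\<^sub>v w) - (?E *\<^sub>v w - ?P *\<^sub>v w))"
    then have i: "i < n" using P by simp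
    have gap_row: "row gap i = real d \<cdot>\<^sub>v (unit_vec n i - row ?P i) - (row ?E i - row ?P i)"
      unfolding gap_def using i P E by (intro eq_vecI) (auto simp: unit_vec_def)
    show "(gap *\<^sub>v w) $ i = (real d \<cdot>\<^sub>v (w - ?P *\<^sub>v w) - (?E *\<^sub>v w - ?P *\<^sub>v w)) $ i"
    proof -
      have rP: "row ?P i \<in> carrier_vec n" and rE: "row ?E i \<in> carrier_vec n" using P E i by auto
      have "(gap *\<^sub>v w) $ i = row gap i \<bullet> w" using gap_carrier i by simp
      also have "\<dots> = real d * (w $ i - row ?P i \<bullet> w) - (row ?E i \<bullet> w - row ?P i \<bullet> w)"
        unfolding gap_row using rP rE w i
        by (simp add: minus_scalar_prod_distrib[of _ n] smult_scalar_prod_distrib[of _ n])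
      finally show ?thesis using P E w i by simp
    qed
  qed (use P gap_carrier in simp)
  then have gap: "v \<bullet> (gap *\<^sub>v w) = real d * (v \<bullet> w - v \<bullet> (?P *\<^sub>v w)) - (v \<bullet> (?E *\<^sub>v w) - v \<bullet> (?P *\<^sub>v w))"
    using v w Pw Ew by (simp add: scalar_prod_minus_distrib[of _ n])
  let ?K = "fact d * det (gram X)" and ?p = "v \<bullet> (?P *\<^sub>v w)"
  have "?K * (v \<bullet> (gap *\<^sub>v w)) = ?K * (?p + real d * (v \<bullet> w - ?p)) - ?K * (v \<bullet> (?E *\<^sub>v w))"
    unfolding gap by (simp add: algebra_simps)
  also have "\<dots> = defect v w"
    unfolding scalar_prod_expected_cov[OF v w] sum_fitted_scalar_prod[OF v w] by simp
  finally show ?thesis .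
qed

lemma index_gap:
  assumes "i < n" "j < n"
  shows "fact d * det (gram X) * gap $$ (i, j) = defect (unit_vec n i) (unit_vec n j)"
proof -
  have "gap *\<^sub>v unit_vec n j \<in> carrier_vec n"
    by (rule mult_mat_vec_carrier[OF gap_carrier unit_vec_carrier])
  then have "unit_vec n i \<bullet> (gap *\<^sub>v unit_vec n j) = gap $$ (i, j)"
    using carrier_matD[OF gap_carrier] assms by simp
  then show ?thesis using scalar_prod_gap[of "unit_vec n i" "unit_vec n j"] by simp
qed

lemma defect_commute: "defect v w = defect w v"
  by (simp add: defect_def mult.commute)

lemma defect_self_nonneg: "defect v v \<ge> 0"
  by (simp add: defect_def sum_nonneg)

text \<open>An injective tuple would give a \<open>d\<close>-element set with positive Gram
  determinant, so a zero minor forces a repeated index. The repetition persists after appending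
  \<open>k\<close>, and the augmented minor has two equal rows.\<close>

lemma defect_general_position:
  assumes "general_position X"
  shows "defect v w = 0"
proof -
  have "det (select_rows (Suc d) (f(d := k)) (augment v)) = 0"
    if f: "f \<in> tuples" "minor f = 0" for f k
  proof -
    have "\<not> inj_on f {0..<d}"
    proof
      assume "inj_on f {0..<d}"
      then have bij: "bij_betw f {0..<d} (f ` {0..<d})" by (simp add: bij_betw_def)
      have "f ` {0..<d} \<subseteq> {0..<n}" using f(1) by auto
      moreover have "card (f ` {0..<d}) = d" using bij_betw_same_card[OF bij] by simp
      ultimately show False
        using assms X f(2) det_gram_row_submatrix[OF X _ bij]
        by (auto simp: general_position_def)
    qed
    moreover have "inj_on (f(d := k)) {0..<d} \<longleftrightarrow> inj_on f {0..<d}"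
      by (intro inj_on_cong) auto
    ultimately have "\<not> inj_on (f(d := k)) {0..<Suc d}"
      using inj_on_subset[of "f(d := k)" "{0..<Suc d}" "{0..<d}"] by auto
    then show ?thesis by (rule det_select_rows_not_inj[OF augment_carrier])
  qed
  then show ?thesis by (simp add: defect_def)
qed

text \<open>Up to the positive factor \<open>?K\<close>, the quadratic form is
  \<open>defect v v\<close>, a sum of squares; symmetry of \<open>defect\<close> on unit vectors
  makes the matrix symmetric.\<close>

lemma gap_psd: "psd gap"
  unfolding psd_def
proof (intro conjI ballI)
  let ?K = "fact d * det (gram X)"
  have K: "?K > 0" using det_gram_pos by simp
  show "square_mat gap" using gap_carrier by simp
  show "transpose_mat gap = gap"
  proof (rule eq_matI)
    fix i j assume "i < dim_row gap" "j < dim_col gap"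
    then have ij: "i < n" "j < n" using gap_carrier by auto
    have "?K * gap $$ (j, i) = ?K * gap $$ (i, j)"
      unfolding index_gap[OF ij] index_gap[OF ij(2,1)] by (rule defect_commute)
    then have "gap $$ (j, i) = gap $$ (i, j)" using det_gram by simp
    then show "transpose_mat gap $$ (i, j) = gap $$ (i, j)"
      using ij gap_carrier by simp
  qed (use gap_carrier in auto)
  fix v :: "real vec" assume "v \<in> carrier_vec (dim_row gap)"
  then have v: "v \<in> carrier_vec n" using gap_carrier by simp
  have "v \<bullet> (gap *\<^sub>v v) = defect v v / ?K"
    using scalar_prod_gap[OF v v, symmetric] det_gram by simp
  then show "0 \<le> v \<bullet> (gap *\<^sub>v v)"
    using defect_self_nonneg K by (simp only: divide_nonneg_pos)
qed

lemma gap_general_position: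
  assumes "general_position X"
  shows "gap = 0\<^sub>m n n"
proof (rule eq_matI)
  fix i j assume "i < dim_row (0\<^sub>m n n :: real mat)" "j < dim_col (0\<^sub>m n n :: real mat)"
  then have ij: "i < n" "j < n" by auto
  show "gap $$ (i, j) = 0\<^sub>m n n $$ (i, j)"
    using index_gap[OF ij] defect_general_position[OF assms] det_gram ij by simp
qed (use gap_carrier in auto)

end

theorem theorem2p7:
  fixes X :: "real mat" and n d :: nat
  assumes "X \<in> carrier_mat n d"
    and "d \<le> n"
    and "vec_space.rank n X = d"
  shows
    "(general_position X \<longrightarrow>
        expectation_mat n n (volume_sampling X)
          (\<lambda>S. transpose_mat (pseudoinverse (diag_indicator n S * X)) * transpose_mat X * X
                 * pseudoinverse (diag_indicator n S * X))
          - proj_col_span X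
        = real d \<cdot>\<^sub>m (1\<^sub>m n - proj_col_span X))
     \<and>
     (\<not> general_position X \<longrightarrow>
        expectation_mat n n (volume_sampling X)
          (\<lambda>S. transpose_mat (pseudoinverse (diag_indicator n S * X)) * transpose_mat X * X
                 * pseudoinverse (diag_indicator n S * X))
          - proj_col_span X
        \<preceq>\<^sub>L real d \<cdot>\<^sub>m (1\<^sub>m n - proj_col_span X))"
proof (intro conjI impI)
  interpret full_column_rank X n d
    using assms(1) det_gram_full_rank[OF assms(1,3)] by unfold_locales
  let ?L = "expected_cov - proj_col_span X" and ?R = "real d \<cdot>\<^sub>m (1\<^sub>m n - proj_col_span X)"
  have L: "?L \<in> carrier_mat n n" and R: "?R \<in> carrier_mat n n"
    using proj_col_span_carrier by (auto intro: minus_carrier_mat)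
  show "?L = ?R" if "general_position X"
  proof (rule eq_matI)
    fix i j assume "i < dim_row ?R" "j < dim_col ?R"
    then have ij: "i < n" "j < n" using carrier_matD[OF R] by simp_all
    have "gap $$ (i, j) = 0" using gap_general_position[OF that] ij by simp
    moreover have "gap $$ (i, j) = ?R $$ (i, j) - ?L $$ (i, j)"
      unfolding gap_def using ij carrier_matD[OF L] by (intro index_minus_mat(1)) simp_all
    ultimately show "?L $$ (i, j) = ?R $$ (i, j)" by linarith
  qed (simp_all only: carrier_matD[OF L] carrier_matD[OF R])
  \<comment> \<open>After unfolding, the order relation is exactly \<open>psd gap\<close>.\<close>
  show "?L \<preceq>\<^sub>L ?R"
    using gap_psd by (simp only: loewner_le_def gap_def carrier_matD[OF L] carrier_matD[OF R] simp_thms)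
qed

end
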